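(* Let $L>0$, let $\mathcal{M}=\{(\dot x_i,x_i,u_i)\}_{i\in I}$, $I=\{1,\dots,T\}$, be a set of measurements with $\dot x_i,x_i\in\mathbb{R}^n$, $u_i\in\mathbb{R}^m$, let $G\in\mathbb{R}^{n\times m}$, and let $Y=[y_1\ \cdots\ y_T]\in\mathbb{R}^{n\times T}$ with $y_i:=\dot x_i-Gu_i$. The pair $(\mathcal{M},G)$ is instantly consistent with a port-Hamiltonian system in the class $\mathcal{H}^+_{0,L}$ of nonnegative convex $L$-smooth Hamiltonians if and only if there exist $A\in\mathbb{R}^{n\times n}$, $g_i\in\mathbb{R}^n$ and $h_i\in\mathbb{R}$ ($i\in I$) such that $$\begin{cases} Y=A\,[g_1\ \cdots\ g_T],\\ A+A^\top\preceq0,\\ h_i-h_j\ \ge\ g_j^\top(x_i-x_j)+\frac{1}{2L}\|g_i-g_j\|^2\quad\text{for all } i,j\in I,\ i\neq j.\end{cases}$$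
   Context: $\|\cdot\|$ is the Euclidean norm; $\succeq,\preceq$ refer to the positive/negative semidefinite order on symmetric matrices. The points $\dot x_i$, $x_i$ are treated as independent vectors (no relation between $\dot x_i$ and a time derivative is imposed). For $L>0$, $\mathcal{H}_{0,L}^+$ is the set of convex functions $H\in C^1(\mathbb{R}^n)$ (real-valued) with $\|\nabla H(x)-\nabla H(y)\|\le L\|x-y\|$ for all $x,y\in\mathbb{R}^n$ and $H(x)\ge0$ for all $x\in\mathbb{R}^n$. Definition (instant consistency). Let $\mathcal{H}$ be a class of nonnegative functions on $\mathbb{R}^n$. The pair $(\mathcal{M},G)$ is instantly consistent with a port-Hamiltonian (pH) system in the class $\mathcal{H}$ if there exist constant matrices $J=-J^\top$, $R=R^\top\succeq0$ in $\mathbb{R}^{n\times n}$ and $H\in\mathcal{H}$ such that $\dot x_i=(J-R)\nabla H(x_i)+Gu_i$ for all $i\in I$. *)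

theory Defs
  imports "HOL-Analysis.Analysis"
begin

definition gradient :: "('a::real_inner \<Rightarrow> real) \<Rightarrow> 'a \<Rightarrow> 'a" where
  "gradient f x = (THE g. GDERIV f x :> g)"

definition pos_semidef :: "real^'n^'n \<Rightarrow> bool" where
  "pos_semidef A \<longleftrightarrow> transpose A = A \<and> (\<forall>v. 0 \<le> v \<bullet> (A *v v))"

definition neg_semidef :: "real^'n^'n \<Rightarrow> bool" where
  "neg_semidef A \<longleftrightarrow> transpose A = A \<and> (\<forall>v. v \<bullet> (A *v v) \<le> 0)"

definition mat_of_columns :: "('t \<Rightarrow> real^'n) \<Rightarrow> real^'t^'n" where
  "mat_of_columns v = (\<chi> k i. v i $ k)"

definition nonneg_convex_smooth :: "real \<Rightarrow> (real^'n \<Rightarrow> real) set" where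
  "nonneg_convex_smooth L = {H.
     convex_on UNIV H \<and>
     (\<forall>x. H differentiable (at x)) \<and> continuous_on UNIV (gradient H) \<and>
     (\<forall>x y. norm (gradient H x - gradient H y) \<le> L * norm (x - y)) \<and>
     (\<forall>x. 0 \<le> H x)}"

(* The measurements are the family M i = (xdot_i, x_i, u_i), with i ranging over a finite index
   type 't that plays the role of I = {1, ..., T}; xdot is unrelated to any derivative of x. *)
definition instantly_consistent ::
  "(real^'n \<Rightarrow> real) set \<Rightarrow> ('t::finite \<Rightarrow> (real^'n) \<times> (real^'n) \<times> (real^'m)) \<Rightarrow> real^'m^'n \<Rightarrow> bool" where
  "instantly_consistent \<H> M G \<longleftrightarrow>
     (\<exists>J R H. transpose J = - J \<and> pos_semidef R \<and> H \<in> \<H> \<and>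
        (\<forall>i. case M i of (xdot, x, u) \<Rightarrow> xdot = (J - R) *v gradient H x + G *v u))"

end

theory Submission
  imports Defs
begin

text \<open>
  Sufficiency: with \<open>c\<^sub>i = h\<^sub>i - g\<^sub>i \<bullet> x\<^sub>i + \<parallel>g\<^sub>i\<parallel>\<^sup>2 / (2 L)\<close>, the Moreau envelope
  \<open>H x = min\<^sub>z k z + L/2 \<parallel>x - z\<parallel>\<^sup>2\<close> of the piecewise affine function
  \<open>k z = max (0, max\<^sub>i (g\<^sub>i \<bullet> z + c\<^sub>i))\<close> is convex and \<open>L\<close>-smooth. The inequalities between data points
  say that the \<open>i\<close>-th piece is the active one at \<open>x\<^sub>i - g\<^sub>i / L\<close>, so that \<open>H\<close> has
  gradient \<open>g\<^sub>i\<close> at \<open>x\<^sub>i\<close>. The piece \<open>0\<close> makes \<open>H\<close> nonnegative; it does not interfere once all \<open>h\<^sub>i\<close>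
  have been shifted by a constant to \<open>h\<^sub>i \<ge> \<parallel>g\<^sub>i\<parallel>\<^sup>2 / (2 L)\<close>.
  Necessity is the usual inequality for \<open>L\<close>-smooth convex functions.
  The matrix condition says that \<open>A = J - R\<close>, by splitting \<open>A\<close> into its skew and symmetric parts.
\<close>

section \<open>Gradients as representatives of the derivative\<close>

lemma gradient_eq:
  assumes "GDERIV f x :> D"
  shows "gradient f x = D"
  unfolding gradient_def
proof (rule the_equality)
  show "GDERIV f x :> D" by fact
next
  fix D' assume "GDERIV f x :> D'"
  then have "(\<lambda>v. v \<bullet> D') = (\<lambda>v. v \<bullet> D)"
    using assms unfolding gderiv_def by (rule has_derivative_unique)
  then show "D' = D"
    by (metis vector_eq_ldot)
qed

text \<open>In finite dimension the derivative is a linear functional, and its adjoint applied to 1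
  is the vector that represents it.\<close>

lemma gderiv_gradient:
  fixes f :: "'a::euclidean_space \<Rightarrow> real"
  assumes "f differentiable (at x)"
  shows "GDERIV f x :> gradient f x"
proof -
  obtain f' where f': "(f has_derivative f') (at x)"
    using assms unfolding differentiable_def by blast
  have "linear f'" using f' by (rule has_derivative_linear)
  then have "f' = (\<lambda>v. v \<bullet> adjoint f' 1)"
    by (simp add: adjoint_works)
  with f' have "GDERIV f x :> adjoint f' 1"
    unfolding gderiv_def by simp
  then show ?thesis using gradient_eq by metis
qed

section \<open>First-order inequalities for convex and for \<open>L\<close>-smooth functions\<close>

lemma gderiv_line:
  fixes f :: "'a::real_inner \<Rightarrow> real"
  assumes "\<And>z. GDERIV f z :> D z"
  shows "((\<lambda>t. f (x + t *\<^sub>R d)) has_real_derivative D (x + t *\<^sub>R d) \<bullet> d) (at t)"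
proof -
  have "((\<lambda>t. x + t *\<^sub>R d) has_derivative (\<lambda>t. t *\<^sub>R d)) (at t)"
    by (auto intro!: derivative_eq_intros)
  moreover have "(f has_derivative (\<lambda>v. v \<bullet> D (x + t *\<^sub>R d))) (at (x + t *\<^sub>R d))"
    using assms unfolding gderiv_def .
  ultimately have "((\<lambda>t. f (x + t *\<^sub>R d)) has_derivative (\<lambda>s. (s *\<^sub>R d) \<bullet> D (x + t *\<^sub>R d))) (at t)"
    by (rule has_derivative_compose)
  moreover have "(\<lambda>s. (s *\<^sub>R d) \<bullet> D (x + t *\<^sub>R d)) = (*) (D (x + t *\<^sub>R d) \<bullet> d)"
    by (simp add: fun_eq_iff inner_commute)
  ultimately show ?thesis
    unfolding has_field_derivative_def by simp
qed

text \<open>Restricting \<open>f\<close> to the line through \<open>x\<close> and \<open>w\<close>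
  reduces this to the tangent inequality in one real variable.\<close>

lemma convex_on_above_tangent_gderiv:
  fixes f :: "'a::real_inner \<Rightarrow> real"
  assumes "convex_on UNIV f" and D: "\<And>z. GDERIV f z :> D z"
  shows "f x + D x \<bullet> (w - x) \<le> f w"
proof -
  define \<phi> where "\<phi> = (\<lambda>t. f (x + t *\<^sub>R (w - x)))"
  have "convex_on UNIV \<phi>"
  proof (rule convex_onI)
    fix t a b :: real assume "0 < t" "t < 1"
    moreover have "x + ((1 - t) *\<^sub>R a + t *\<^sub>R b) *\<^sub>R (w - x)
        = (1 - t) *\<^sub>R (x + a *\<^sub>R (w - x)) + t *\<^sub>R (x + b *\<^sub>R (w - x))"
      by (simp add: algebra_simps)
    ultimately show "\<phi> ((1 - t) *\<^sub>R a + t *\<^sub>R b) \<le> (1 - t) * \<phi> a + t * \<phi> b"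
      unfolding \<phi>_def using convex_onD[OF assms(1), of t] by simp
  qed simp
  moreover have "(\<phi> has_real_derivative D x \<bullet> (w - x)) (at 0 within UNIV)"
    unfolding \<phi>_def using gderiv_line[OF D, of x "w - x" 0] by simp
  ultimately have "\<phi> 1 - \<phi> 0 \<ge> (D x \<bullet> (w - x)) * (1 - 0)"
    by (intro convex_on_imp_above_tangent[where A = UNIV]) auto
  then show ?thesis by (simp add: \<phi>_def)
qed

lemma descent_lemma:
  fixes f :: "'a::real_inner \<Rightarrow> real"
  assumes D: "\<And>z. GDERIV f z :> D z"
    and lip: "\<And>z w. norm (D z - D w) \<le> L * norm (z - w)"
  shows "f w \<le> f x + D x \<bullet> (w - x) + L / 2 * (norm (w - x))\<^sup>2"
proof -
  define d where "d = w - x"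
  \<comment> \<open>Along the segment, \<open>f\<close> minus the linear and quadratic terms of the
    bound. Cauchy-Schwarz and the Lipschitz condition make its derivative nonpositive.\<close>
  define \<phi> where "\<phi> = (\<lambda>t. f (x + t *\<^sub>R d) - t * (D x \<bullet> d) - L / 2 * t\<^sup>2 * (norm d)\<^sup>2)"
  have "\<phi> 1 \<le> \<phi> 0"
  proof (rule DERIV_nonpos_imp_nonincreasing[where f = \<phi>])
    fix t :: real assume t: "0 \<le> t" "t \<le> 1"
    have "(\<phi> has_real_derivative D (x + t *\<^sub>R d) \<bullet> d - D x \<bullet> d - L * t * (norm d)\<^sup>2) (at t)"
      unfolding \<phi>_def by (auto intro!: derivative_eq_intros gderiv_line[OF D])
    moreover have "D (x + t *\<^sub>R d) \<bullet> d - D x \<bullet> d - L * t * (norm d)\<^sup>2 \<le> 0"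
    proof -
      have "(D (x + t *\<^sub>R d) - D x) \<bullet> d \<le> norm (D (x + t *\<^sub>R d) - D x) * norm d"
        by (rule norm_cauchy_schwarz)
      also have "\<dots> \<le> (L * norm (t *\<^sub>R d)) * norm d"
        using lip[of "x + t *\<^sub>R d" x] by (intro mult_right_mono) auto
      finally show ?thesis using t by (simp add: inner_diff_left power2_eq_square mult.assoc)
    qed
    ultimately show "\<exists>y. (\<phi> has_real_derivative y) (at t) \<and> y \<le> 0" by blast
  qed simp
  then show ?thesis by (simp add: \<phi>_def d_def)
qed

text \<open>The tangent at \<open>w\<close> and the quadratic upper bound at \<open>x\<close> are compared at the minimiser
  \<open>x - (D x - D w) / L\<close> of their difference.\<close>
lemma smooth_convex_interpolation_ineq:
  fixes f :: "'a::real_inner \<Rightarrow> real"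
  assumes "L > 0"
    and lower: "\<And>x w. f x + D x \<bullet> (w - x) \<le> f w"
    and upper: "\<And>x w. f w \<le> f x + D x \<bullet> (w - x) + L / 2 * (norm (w - x))\<^sup>2"
  shows "f x - f w \<ge> D w \<bullet> (x - w) + 1 / (2 * L) * (norm (D x - D w))\<^sup>2"
proof -
  define e where "e = D x - D w"
  define v where "v = x - (1 / L) *\<^sub>R e"
  have "f w + D w \<bullet> (v - w) \<le> f x + D x \<bullet> (v - x) + L / 2 * (norm (v - x))\<^sup>2"
    using lower[of w v] upper[of v x] by linarith
  moreover have "D w \<bullet> (v - w) = D w \<bullet> (x - w) - (1 / L) * (D w \<bullet> e)"
    by (simp add: v_def inner_diff_right)
  moreover have "D x \<bullet> (v - x) = - (1 / L) * (D x \<bullet> e)"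
    by (simp add: v_def)
  moreover have "L / 2 * (norm (v - x))\<^sup>2 = 1 / (2 * L) * (norm e)\<^sup>2"
    using \<open>L > 0\<close> by (simp add: v_def power_divide power2_eq_square)
  moreover have "(1 / L) * (D x \<bullet> e) - (1 / L) * (D w \<bullet> e) = 1 / L * (norm e)\<^sup>2"
    by (simp add: e_def power2_norm_eq_inner inner_diff_left diff_divide_distrib)
  moreover have "1 / L * (norm e)\<^sup>2 = 2 * (1 / (2 * L) * (norm e)\<^sup>2)"
    by simp
  ultimately show ?thesis unfolding e_def by linarith
qed

text \<open>Adding the hypothesis to itself with \<open>x\<close> and \<open>w\<close> swapped
  cancels the values of \<open>f\<close> and leaves cocoercivity of \<open>D\<close>. Cauchy-Schwarz
  and cancelling one factor \<open>norm (D x - D w)\<close> finish.\<close>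

lemma lipschitz_gradient_of_interpolation_ineq:
  fixes f :: "'a::real_inner \<Rightarrow> real"
  assumes "L > 0"
    and ineq: "\<And>x w. f x - f w \<ge> D w \<bullet> (x - w) + 1 / (2 * L) * (norm (D x - D w))\<^sup>2"
  shows "norm (D x - D w) \<le> L * norm (x - w)"
proof -
  have "1 / (2 * L) * (norm (D x - D w))\<^sup>2 + 1 / (2 * L) * (norm (D x - D w))\<^sup>2
      \<le> (D x - D w) \<bullet> (x - w)"
    using ineq[of w x] ineq[of x w]
    by (simp add: norm_minus_commute inner_diff_left inner_diff_right)
  also have "\<dots> \<le> norm (D x - D w) * norm (x - w)"
    by (rule norm_cauchy_schwarz)
  finally have "norm (D x - D w) * norm (D x - D w) \<le> norm (D x - D w) * (L * norm (x - w))"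
    using \<open>L > 0\<close> by (simp add: field_simps power2_eq_square)
  then show ?thesis
    using \<open>L > 0\<close> by (cases "norm (D x - D w) = 0") (simp_all only: mult_le_cancel_left, auto)
qed

text \<open>Differentiability of the envelope will come from this squeeze, without differentiating a
  minimum: the remainder divided by \<open>norm (w - x)\<close> is at most
  \<open>K * norm (w - x)\<close>.\<close>

lemma gderiv_of_quadratic_bounds:
  fixes f :: "'a::real_inner \<Rightarrow> real"
  assumes "\<And>w. \<bar>f w - f x - D \<bullet> (w - x)\<bar> \<le> K * (norm (w - x))\<^sup>2"
  shows "GDERIV f x :> D"
  unfolding gderiv_def has_derivative_at2
proof (intro conjI)
  show "bounded_linear (\<lambda>v. v \<bullet> D)" by (rule bounded_linear_inner_left)
  have "((\<lambda>w. K * norm (w - x)) \<longlongrightarrow> 0) (at x)"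
    by (auto intro!: tendsto_eq_intros)
  then show "((\<lambda>w. (1 / norm (w - x)) *\<^sub>R (f w - (f x + (w - x) \<bullet> D))) \<longlongrightarrow> 0) (at x)"
  proof (rule Lim_null_comparison[rotated])
    have "norm ((1 / norm (w - x)) *\<^sub>R (f w - (f x + (w - x) \<bullet> D))) \<le> K * norm (w - x)"
      if "w \<noteq> x" for w
      using assms[of w] that
      by (simp add: field_simps power2_eq_square inner_commute[of D])
    then show "\<forall>\<^sub>F w in at x. norm ((1 / norm (w - x)) *\<^sub>R (f w - (f x + (w - x) \<bullet> D)))
        \<le> K * norm (w - x)"
      by (auto simp: eventually_at_filter)
  qed
qed

section \<open>The Moreau envelope of a nonnegative convex function\<close>

lemma convex_on_power2_norm: "convex_on UNIV (\<lambda>x::'a::real_inner. (norm x)\<^sup>2)"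
proof (rule convex_onI)
  fix t :: real and x w :: 'a assume t: "0 < t" "t < 1"
  have "(1 - t) * (norm x)\<^sup>2 + t * (norm w)\<^sup>2 - (norm ((1 - t) *\<^sub>R x + t *\<^sub>R w))\<^sup>2
      = t * (1 - t) * (norm (x - w))\<^sup>2"
    by (simp add: power2_norm_eq_inner inner_simps inner_commute[of w x], algebra)
  also have "\<dots> \<ge> 0" using t by simp
  finally show "(norm ((1 - t) *\<^sub>R x + t *\<^sub>R w))\<^sup>2 \<le> (1 - t) * (norm x)\<^sup>2 + t * (norm w)\<^sup>2"
    by simp
qed simp

lemma moreau_envelope_attained:
  fixes k :: "'a::euclidean_space \<Rightarrow> real"
  assumes "L > 0" "continuous_on UNIV k" "\<And>z. 0 \<le> k z"
  shows "\<exists>p. \<forall>z. k p + L / 2 * (norm (x - p))\<^sup>2 \<le> k z + L / 2 * (norm (x - z))\<^sup>2"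
proof -
  \<comment> \<open>At distance \<open>r\<close> from \<open>x\<close> the penalty alone equals
    \<open>k x\<close>, the objective at \<open>x\<close>. As \<open>k\<close> is nonnegative, no
    point outside the ball beats \<open>x\<close>, so minimising over the compact ball
    suffices.\<close>
  define r where "r = sqrt (2 * k x / L)"
  define q where "q = (\<lambda>z. k z + L / 2 * (norm (x - z))\<^sup>2)"
  have r: "r \<ge> 0" "L / 2 * r\<^sup>2 = k x"
    using assms by (auto simp: r_def)
  have "continuous_on (cball x r) q"
    unfolding q_def by (intro continuous_intros continuous_on_subset[OF assms(2)]) auto
  then obtain p where p: "\<And>z. z \<in> cball x r \<Longrightarrow> q p \<le> q z"
    using continuous_attains_inf[of "cball x r" q] r by (metis centre_in_cball compact_cball empty_iff)
  have "q p \<le> q z" for z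
  proof (cases "z \<in> cball x r")
    case False
    then have "r\<^sup>2 \<le> (norm (x - z))\<^sup>2"
      using r by (intro power_mono) (auto simp: dist_norm)
    then have "k x \<le> L / 2 * (norm (x - z))\<^sup>2"
      using \<open>L > 0\<close> by (simp flip: r(2))
    then have "q x \<le> q z"
      using assms(3)[of z] by (simp add: q_def)
    moreover have "q p \<le> q x" using r by (intro p) simp
    ultimately show ?thesis by simp
  qed (rule p)
  then show ?thesis unfolding q_def by blast
qed

lemma moreau_envelope:
  fixes k :: "real^'n \<Rightarrow> real"
  assumes "L > 0" and k: "convex_on UNIV k" "\<And>z. 0 \<le> k z"
  obtains H where "H \<in> nonneg_convex_smooth L"
    and "\<And>x z. H x \<le> k z + L / 2 * (norm (x - z))\<^sup>2"
    and "\<And>x. \<exists>z. H x = k z + L / 2 * (norm (x - z))\<^sup>2"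
    and "\<And>x w. H w \<le> H x + gradient H x \<bullet> (w - x) + L / 2 * (norm (w - x))\<^sup>2"
proof -
  have "continuous_on UNIV k"
    using k(1) by (intro convex_on_continuous) auto
  then obtain p where p: "\<And>x z. k (p x) + L / 2 * (norm (x - p x))\<^sup>2 \<le> k z + L / 2 * (norm (x - z))\<^sup>2"
    using moreau_envelope_attained[OF \<open>L > 0\<close>] k(2) by metis
  define H where "H = (\<lambda>x. k (p x) + L / 2 * (norm (x - p x))\<^sup>2)"
  \<comment> \<open>The gradient at \<open>x\<close> of the penalty with its centre frozen at the
    minimiser \<open>p x\<close>.\<close>
  define D where "D = (\<lambda>x. L *\<^sub>R (x - p x))"
  have H_le: "H x \<le> k z + L / 2 * (norm (x - z))\<^sup>2" for x z
    unfolding H_def by (rule p)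
  have convex: "convex_on UNIV H"
  proof (rule convex_onI)
    fix t :: real and x w :: "real^'n" assume t: "0 < t" "t < 1"
    \<comment> \<open>The convex combination of the two minimisers competes in the minimum at the
      combined point.\<close>
    let ?z = "(1 - t) *\<^sub>R p x + t *\<^sub>R p w"
    have "H ((1 - t) *\<^sub>R x + t *\<^sub>R w)
        \<le> k ?z + L / 2 * (norm (((1 - t) *\<^sub>R x + t *\<^sub>R w) - ?z))\<^sup>2"
      by (rule H_le)
    also have "((1 - t) *\<^sub>R x + t *\<^sub>R w) - ?z = (1 - t) *\<^sub>R (x - p x) + t *\<^sub>R (w - p w)"
      by (simp add: algebra_simps)
    also have "k ?z + L / 2 * (norm \<dots>)\<^sup>2
        \<le> ((1 - t) * k (p x) + t * k (p w))
          + L / 2 * ((1 - t) * (norm (x - p x))\<^sup>2 + t * (norm (w - p w))\<^sup>2)"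
      using t \<open>L > 0\<close> convex_onD[OF k(1), of t "p x" "p w"]
        convex_onD[OF convex_on_power2_norm, of t "x - p x" "w - p w"]
      by (intro add_mono mult_left_mono) auto
    also have "\<dots> = (1 - t) * H x + t * H w"
      by (simp add: H_def algebra_simps add_divide_distrib diff_divide_distrib)
    finally show "H ((1 - t) *\<^sub>R x + t *\<^sub>R w) \<le> (1 - t) * H x + t * H w" .
  qed simp
  \<comment> \<open>The minimiser \<open>p x\<close> for \<open>x\<close> is a competitor at
    \<open>w\<close>; expanding the square around \<open>x\<close> gives the bound.\<close>
  have upper: "H w \<le> H x + D x \<bullet> (w - x) + L / 2 * (norm (w - x))\<^sup>2" for x w
  proof -
    have "(norm (w - p x))\<^sup>2 = (norm (x - p x))\<^sup>2 + 2 * ((x - p x) \<bullet> (w - x)) + (norm (w - x))\<^sup>2"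
      by (simp add: power2_norm_eq_inner algebra_simps inner_commute)
    then have "L / 2 * (norm (w - p x))\<^sup>2
        = L / 2 * (norm (x - p x))\<^sup>2 + D x \<bullet> (w - x) + L / 2 * (norm (w - x))\<^sup>2"
      by (simp add: D_def distrib_left)
    then show ?thesis using H_le[of w "p x"] unfolding H_def by linarith
  qed
  \<comment> \<open>Since \<open>x\<close> is the midpoint of \<open>w\<close> and its reflection,
    convexity bounds \<open>H w\<close> below by twice \<open>H x\<close> minus the value at the
    reflection, and \<open>upper\<close> applies to that value.\<close>
  have reflected: "H w \<ge> H x + D x \<bullet> (w - x) - L / 2 * (norm (w - x))\<^sup>2" for x w
  proof -
    have "(1 - 1 / 2) *\<^sub>R w + (1 / 2) *\<^sub>R (2 *\<^sub>R x - w) = x"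
      by (simp add: algebra_simps)
    then have "H x \<le> H w / 2 + H (2 *\<^sub>R x - w) / 2"
      using convex_onD[OF convex, of "1 / 2" w "2 *\<^sub>R x - w"] by simp
    moreover have "2 *\<^sub>R x - w - x = - (w - x)"
      by (simp add: algebra_simps scaleR_2)
    then have "H (2 *\<^sub>R x - w) \<le> H x - D x \<bullet> (w - x) + L / 2 * (norm (w - x))\<^sup>2"
      using upper[of "2 *\<^sub>R x - w" x] by (simp only: inner_minus_right norm_minus_cancel)
    ultimately show ?thesis by linarith
  qed
  have gderiv: "GDERIV H x :> D x" for x
  proof (rule gderiv_of_quadratic_bounds[where K = "L / 2"])
    fix w
    show "\<bar>H w - H x - D x \<bullet> (w - x)\<bar> \<le> L / 2 * (norm (w - x))\<^sup>2"
      using upper[of w x] reflected[of x w] by linarith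
  qed
  then have grad: "gradient H = D"
    by (intro ext gradient_eq)
  have lower: "H x + D x \<bullet> (w - x) \<le> H w" for x w
    by (rule convex_on_above_tangent_gderiv[OF convex gderiv])
  have lipschitz: "norm (D x - D w) \<le> L * norm (x - w)" for x w
    by (rule lipschitz_gradient_of_interpolation_ineq[OF \<open>L > 0\<close>
          smooth_convex_interpolation_ineq[OF \<open>L > 0\<close> lower upper]])
  have "L-lipschitz_on UNIV D"
    using lipschitz \<open>L > 0\<close> by (intro lipschitz_onI) (auto simp: dist_norm)
  then have "continuous_on UNIV D"
    by (rule lipschitz_on_continuous_on)
  moreover have "H differentiable (at x)" for x
    using gderiv unfolding gderiv_def differentiable_def by blast
  moreover have "0 \<le> H x" for x
    using k(2) \<open>L > 0\<close> by (simp add: H_def)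
  ultimately have "H \<in> nonneg_convex_smooth L"
    using convex lipschitz by (simp add: nonneg_convex_smooth_def grad)
  moreover have "\<exists>z. H x = k z + L / 2 * (norm (x - z))\<^sup>2" for x
    unfolding H_def by blast
  ultimately show thesis
    using H_le upper by (intro that[of H]) (simp_all only: grad)
qed

section \<open>Interpolation of gradient data, and its necessary condition\<close>

lemma smooth_convex_interpolation:
  fixes x g :: "'t::finite \<Rightarrow> real^'n" and h :: "'t \<Rightarrow> real"
  assumes "L > 0"
    and ineq: "\<And>i j. i \<noteq> j \<Longrightarrow> h i - h j \<ge> g j \<bullet> (x i - x j) + 1 / (2 * L) * (norm (g i - g j))\<^sup>2"
  obtains H where "H \<in> nonneg_convex_smooth L" and "\<And>i. gradient H (x i) = g i"
proof -
  \<comment> \<open>Large enough that adding \<open>C\<close> lifts every \<open>h i\<close> to the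
    bound in \<open>f_ge\<close>; a common shift leaves all differences unchanged.\<close>
  define C where "C = (\<Sum>i\<in>UNIV. \<bar>1 / (2 * L) * (norm (g i))\<^sup>2 - h i\<bar>)"
  define f where "f = (\<lambda>i. h i + C)"
  have f_ge: "f i \<ge> 1 / (2 * L) * (norm (g i))\<^sup>2" for i
  proof -
    have "\<bar>1 / (2 * L) * (norm (g i))\<^sup>2 - h i\<bar> \<le> C"
      unfolding C_def by (intro member_le_sum) auto
    then show ?thesis by (simp add: f_def)
  qed
  have f_ineq: "f i \<ge> f j + g j \<bullet> (x i - x j) + 1 / (2 * L) * (norm (g i - g j))\<^sup>2" for i j
    using ineq[of i j] by (cases "i = j") (auto simp: f_def)

  \<comment> \<open>The envelope of an affine function with slope \<open>g i\<close> lies below it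
    by the constant \<open>1 / (2 * L) * (norm (g i))\<^sup>2\<close>. Adding this constant makes
    the envelope of \<open>a i\<close> the affine function with value \<open>f i\<close> at
    \<open>x i\<close>.\<close>
  define a where "a = (\<lambda>i z. f i + g i \<bullet> (z - x i) + 1 / (2 * L) * (norm (g i))\<^sup>2)"
  define k where "k = (\<lambda>z. Max (insert 0 (range (\<lambda>i. a i z))))"
  have k_le: "k z \<le> b \<longleftrightarrow> 0 \<le> b \<and> (\<forall>i. a i z \<le> b)" for z b
    by (auto simp: k_def)
  have k_nonneg: "0 \<le> k z" and a_le: "a i z \<le> k z" for z i
    using k_le[of z "k z"] by auto
  have "convex_on UNIV k"
  proof (rule convex_onI)
    fix t :: real and z w :: "real^'n" assume t: "0 < t" "t < 1"
    have "a i ((1 - t) *\<^sub>R z + t *\<^sub>R w) \<le> (1 - t) * k z + t * k w" for i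
    proof -
      have "a i ((1 - t) *\<^sub>R z + t *\<^sub>R w) = (1 - t) * a i z + t * a i w"
        by (simp add: a_def inner_simps algebra_simps add_divide_distrib diff_divide_distrib)
      also have "\<dots> \<le> (1 - t) * k z + t * k w"
        using t by (intro add_mono mult_left_mono a_le) auto
      finally show ?thesis .
    qed
    then show "k ((1 - t) *\<^sub>R z + t *\<^sub>R w) \<le> (1 - t) * k z + t * k w"
      using t by (simp add: k_le k_nonneg)
  qed simp
  then obtain H where H: "H \<in> nonneg_convex_smooth L"
    and H_le: "\<And>x z. H x \<le> k z + L / 2 * (norm (x - z))\<^sup>2"
    and H_ex: "\<And>x. \<exists>z. H x = k z + L / 2 * (norm (x - z))\<^sup>2"
    and upper: "\<And>x w. H w \<le> H x + gradient H x \<bullet> (w - x) + L / 2 * (norm (w - x))\<^sup>2"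
    by (rule moreau_envelope[OF \<open>L > 0\<close> _ k_nonneg]) (rule that)
  have "gradient H (x i) = g i" for i
  proof -
    have Hx: "H (x i) \<le> f i"
    proof -
      \<comment> \<open>The minimiser in the envelope of \<open>a i\<close> at \<open>x i\<close>.
        By \<open>f_ineq\<close> no other affine piece exceeds \<open>a i\<close> there, and by
        \<open>f_ge\<close> neither does the piece 0.\<close>
      let ?z = "x i - (1 / L) *\<^sub>R g i"
      have "a j ?z \<le> f i - 1 / (2 * L) * (norm (g i))\<^sup>2" for j
      proof -
        have "1 / (2 * L) * (norm (g i - g j))\<^sup>2
            = 1 / (2 * L) * (norm (g i))\<^sup>2 - 1 / L * (g j \<bullet> g i) + 1 / (2 * L) * (norm (g j))\<^sup>2"
          using \<open>L > 0\<close> by (simp add: power2_norm_eq_inner inner_simps inner_commute field_simps)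
        then show ?thesis
          using f_ineq[of j i] by (simp add: a_def inner_diff_right)
      qed
      then have "k ?z \<le> f i - 1 / (2 * L) * (norm (g i))\<^sup>2"
        using f_ge[of i] by (simp add: k_le)
      moreover have "L / 2 * (norm (x i - ?z))\<^sup>2 = 1 / (2 * L) * (norm (g i))\<^sup>2"
        using \<open>L > 0\<close> by (simp add: power_divide power2_eq_square)
      ultimately show ?thesis using H_le[of "x i" ?z] by linarith
    qed
    have sub: "f i + g i \<bullet> (w - x i) \<le> H w" for w
    proof -
      obtain z where z: "H w = k z + L / 2 * (norm (w - z))\<^sup>2"
        using H_ex by blast
      \<comment> \<open>Completing the square: the penalty at distance \<open>w - z\<close> makes up
        for the difference between \<open>a i z\<close> and the affine minorant at
        \<open>w\<close>.\<close>
      have "0 \<le> 1 / (2 * L) * (norm (g i - L *\<^sub>R (w - z)))\<^sup>2"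
        using \<open>L > 0\<close> by simp
      also have "\<dots> = 1 / (2 * L) * (norm (g i))\<^sup>2 - g i \<bullet> (w - z) + L / 2 * (norm (w - z))\<^sup>2"
        using \<open>L > 0\<close> unfolding power2_norm_eq_inner
        by (simp add: inner_simps inner_commute field_simps)
      finally show ?thesis
        using a_le[of i z] z by (simp add: a_def inner_diff_right)
    qed
    \<comment> \<open>At \<open>x i\<close> the affine minorant of slope \<open>g i\<close> meets
      the quadratic majorant of slope \<open>gradient H (x i)\<close>. A step \<open>e / L\<close>
      along the slope difference gains \<open>(norm e)\<^sup>2 / L\<close> but may gain at most half
      of that, so \<open>e\<close> vanishes.\<close>
    define e where "e = g i - gradient H (x i)"
    let ?w = "x i + (1 / L) *\<^sub>R e"
    have "e \<bullet> (?w - x i) = g i \<bullet> (?w - x i) - gradient H (x i) \<bullet> (?w - x i)"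
      unfolding e_def by (rule inner_diff_left)
    then have "e \<bullet> (?w - x i) \<le> L / 2 * (norm (?w - x i))\<^sup>2"
      using sub[of ?w] upper[of ?w "x i"] Hx by linarith
    moreover have "e \<bullet> (?w - x i) = (norm e)\<^sup>2 / L"
      by (simp add: power2_norm_eq_inner)
    moreover have "L / 2 * (norm (?w - x i))\<^sup>2 = (norm e)\<^sup>2 / L / 2"
      using \<open>L > 0\<close> by (simp add: power_divide power2_eq_square)
    ultimately have "(norm e)\<^sup>2 / L \<le> (norm e)\<^sup>2 / L / 2"
      by (simp only:)
    then have "(norm e)\<^sup>2 \<le> 0"
      using \<open>L > 0\<close> by (simp add: field_simps)
    then show ?thesis by (simp add: e_def)
  qed
  with H that show thesis by blast
qed

lemma nonneg_convex_smooth_interpolation_ineq: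
  fixes H :: "real^'n \<Rightarrow> real"
  assumes "L > 0" "H \<in> nonneg_convex_smooth L"
  shows "H x - H w \<ge> gradient H w \<bullet> (x - w) + 1 / (2 * L) * (norm (gradient H x - gradient H w))\<^sup>2"
proof -
  have "GDERIV H z :> gradient H z" for z
    using assms by (intro gderiv_gradient) (simp add: nonneg_convex_smooth_def)
  then show ?thesis
    using assms unfolding nonneg_convex_smooth_def
    by (intro smooth_convex_interpolation_ineq convex_on_above_tangent_gderiv descent_lemma) auto
qed

section \<open>The matrix conditions and the equivalence\<close>

lemma mat_of_columns_eq_mult_iff:
  "mat_of_columns v = A ** mat_of_columns g \<longleftrightarrow> (\<forall>i. v i = A *v g i)"
  by (auto simp: vec_eq_iff mat_of_columns_def matrix_matrix_mult_def matrix_vector_mult_def)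

text \<open>\<open>J\<close> is the skew part of \<open>A\<close> and \<open>R\<close> is minus its
  symmetric part; conversely the skew parts cancel in \<open>A + transpose A\<close>, leaving -2
  times \<open>R\<close>.\<close>

lemma neg_semidef_iff_structure_dissipation:
  fixes A :: "real^'n^'n"
  shows "neg_semidef (A + transpose A)
    \<longleftrightarrow> (\<exists>J R. transpose J = - J \<and> pos_semidef R \<and> A = J - R)"
proof
  assume A: "neg_semidef (A + transpose A)"
  define J where "J = (1 / 2) *\<^sub>R (A - transpose A)"
  define R where "R = (- 1 / 2) *\<^sub>R (A + transpose A)"
  have "transpose J = - J" "transpose R = R" "A = J - R"
    by (simp_all add: J_def R_def vec_eq_iff transpose_def field_simps)
  moreover have "v \<bullet> (R *v v) = (- 1 / 2) * (v \<bullet> ((A + transpose A) *v v))" for v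
    unfolding R_def by (simp only: inner_scaleR_right flip: scaleR_matrix_vector_assoc)
  then have "pos_semidef R"
    using A \<open>transpose R = R\<close> by (simp add: pos_semidef_def neg_semidef_def)
  ultimately show "\<exists>J R. transpose J = - J \<and> pos_semidef R \<and> A = J - R" by blast
next
  assume "\<exists>J R. transpose J = - J \<and> pos_semidef R \<and> A = J - R"
  then obtain J R where JR: "transpose J = - J" "pos_semidef R" "A = J - R" by blast
  have "transpose A = transpose J - transpose R"
    by (simp add: JR(3) transpose_def vec_eq_iff)
  then have sum: "A + transpose A = (- 2) *\<^sub>R R"
    using JR by (simp add: pos_semidef_def scaleR_2)
  have "v \<bullet> ((A + transpose A) *v v) = (- 2) * (v \<bullet> (R *v v))" for v
    unfolding sum by (simp only: inner_scaleR_right flip: scaleR_matrix_vector_assoc)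
  moreover have "transpose (A + transpose A) = A + transpose A"
    by (simp add: transpose_def vec_eq_iff)
  ultimately show "neg_semidef (A + transpose A)"
    using JR(2) by (simp add: pos_semidef_def neg_semidef_def)
qed

theorem corollary3p1:
  fixes L :: real
    and xdot x y :: "'t::finite \<Rightarrow> real^'n"
    and u :: "'t \<Rightarrow> real^'m"
    and M :: "'t \<Rightarrow> (real^'n) \<times> (real^'n) \<times> (real^'m)"
    and G :: "real^'m^'n"
    and Y :: "real^'t^'n"
  assumes "L > 0"
    and "M = (\<lambda>i. (xdot i, x i, u i))"
    and "y = (\<lambda>i. xdot i - G *v u i)"
    and "Y = mat_of_columns y"
  shows "instantly_consistent (nonneg_convex_smooth L) M G \<longleftrightarrow>
    (\<exists>(A :: real^'n^'n) (g :: 't \<Rightarrow> real^'n) (h :: 't \<Rightarrow> real).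
       Y = A ** mat_of_columns g \<and>
       neg_semidef (A + transpose A) \<and>
       (\<forall>i j. i \<noteq> j \<longrightarrow>
          h i - h j \<ge> g j \<bullet> (x i - x j) + 1 / (2 * L) * (norm (g i - g j))\<^sup>2))"
proof
  assume "instantly_consistent (nonneg_convex_smooth L) M G"
  then obtain J R H where JR: "transpose J = - J" "pos_semidef R"
    and H: "H \<in> nonneg_convex_smooth L"
    and "\<And>i. xdot i = (J - R) *v gradient H (x i) + G *v u i"
    unfolding instantly_consistent_def assms(2) by auto
  then have "Y = (J - R) ** mat_of_columns (\<lambda>i. gradient H (x i))"
    by (simp add: assms(3,4) mat_of_columns_eq_mult_iff)
  moreover have "neg_semidef ((J - R) + transpose (J - R))"
    using JR neg_semidef_iff_structure_dissipation by blast
  ultimately show "\<exists>A g h. Y = A ** mat_of_columns g \<and> neg_semidef (A + transpose A) \<and>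
      (\<forall>i j. i \<noteq> j \<longrightarrow>
        h i - h j \<ge> g j \<bullet> (x i - x j) + 1 / (2 * L) * (norm (g i - g j))\<^sup>2)"
    using nonneg_convex_smooth_interpolation_ineq[OF assms(1) H]
    by (intro exI[of _ "J - R"] exI[of _ "\<lambda>i. gradient H (x i)"] exI[of _ "\<lambda>i. H (x i)"]) auto
next
  assume "\<exists>A g h. Y = A ** mat_of_columns g \<and> neg_semidef (A + transpose A) \<and>
      (\<forall>i j. i \<noteq> j \<longrightarrow>
        h i - h j \<ge> g j \<bullet> (x i - x j) + 1 / (2 * L) * (norm (g i - g j))\<^sup>2)"
  then obtain A g h where Y: "Y = A ** mat_of_columns g" and A: "neg_semidef (A + transpose A)"
    and ineq: "\<And>i j. i \<noteq> j \<Longrightarrow>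
      h i - h j \<ge> g j \<bullet> (x i - x j) + 1 / (2 * L) * (norm (g i - g j))\<^sup>2"
    by blast
  obtain J R where JR: "transpose J = - J" "pos_semidef R" "A = J - R"
    using A neg_semidef_iff_structure_dissipation by blast
  obtain H where H: "H \<in> nonneg_convex_smooth L" "\<And>i. gradient H (x i) = g i"
    using smooth_convex_interpolation[where x = x and g = g and h = h, OF assms(1) ineq] by blast
  have "xdot i = A *v g i + G *v u i" for i
    using Y by (simp add: assms(3,4) mat_of_columns_eq_mult_iff diff_eq_eq)
  then show "instantly_consistent (nonneg_convex_smooth L) M G"
    unfolding instantly_consistent_def assms(2) using JR H
    by (intro exI[of _ J] exI[of _ R] exI[of _ H]) auto
qed

end
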